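(* Let $\lambda$ be a nonzero real number, $\alpha$ a nonzero complex number and $r\ge0$ an integer. For every integer $n\ge1$, $$(x)_{n,\lambda}=\frac{1}{(n+r)_{r}}A_{n+r,\lambda}^{(r,\alpha)}(x)-\sum_{k=0}^{n-1}\sum_{j=1}^{n-k}(-\alpha)_{j}\Big(\frac{1}{2}\Big)^{j}\binom{n}{k}S_{2,\lambda}(n-k,j)(x)_{k,\lambda}.$$
   Context: For nonzero real $\lambda$: $(x)_{0,\lambda}=1$, $(x)_{n,\lambda}=x(x-\lambda)\cdots(x-(n-1)\lambda)$; $e_\lambda^x(t)=(1+\lambda t)^{x/\lambda}=\sum_{n\ge0}(x)_{n,\lambda}\frac{t^n}{n!}$, $e_\lambda(t)=e_\lambda^1(t)$. For complex $y$, $(y)_0=1$, $(y)_k=y(y-1)\cdots(y-k+1)$. The generalized degenerate Euler-Genocchi polynomials of order $\alpha$ are defined by $t^{r}\Big(\frac{2}{e_{\lambda}(t)+1}\Big)^{\alpha}e_{\lambda}^{x}(t)=\sum_{n\ge0}A_{n,\lambda}^{(r,\alpha)}(x)\frac{t^{n}}{n!}$. The degenerate Stirling numbers of the second kind are defined by $(x)_{n,\lambda}=\sum_{k=0}^{n}S_{2,\lambda}(n,k)(x)_{k}$. *)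

theory Defs
  imports Complex_Main "HOL-Computational_Algebra.Formal_Power_Series"
begin

definition falling_fact :: "complex \<Rightarrow> nat \<Rightarrow> complex" where
  "falling_fact y k = (\<Prod>i<k. y - of_nat i)"

definition degen_falling_fact :: "real \<Rightarrow> complex \<Rightarrow> nat \<Rightarrow> complex" where
  "degen_falling_fact lam x n = (\<Prod>i<n. x - of_nat i * of_real lam)"

(* The complex power F^a = (1 + (F - 1))^a, by the binomial series; meaningful for series F
   with constant term 1 (otherwise the composition has no meaning as a formal series).
   It corresponds to the principal branch near t = 0. *)
definition fps_cpower :: "complex fps \<Rightarrow> complex \<Rightarrow> complex fps" where
  "fps_cpower F a = fps_compose (fps_binomial a) (F - 1)"

lemma fps_cpower_of_nat:
  assumes "fps_nth F 0 = 1"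
  shows "fps_cpower F (of_nat n) = F ^ n"
proof -
  have 0: "fps_nth (F - 1) 0 = 0" using assms by simp
  have "fps_cpower F (of_nat n) = (fps_compose (1 + fps_X) (F - 1)) ^ n"
    by (simp only: fps_cpower_def fps_binomial_of_nat fps_compose_power[OF 0])
  also have "fps_compose (1 + fps_X) (F - 1) = F"
    by (simp add: fps_compose_add_distrib fps_X_fps_compose_startby0[OF 0])
  finally show ?thesis .
qed

lemma fps_cpower_add:
  assumes "fps_nth F 0 = 1"
  shows "fps_cpower F (a + b) = fps_cpower F a * fps_cpower F b"
  using assms by (simp add: fps_cpower_def fps_binomial_add_mult fps_compose_mult_distrib)

(* e_lam^x(t) = (1 + lam t)^(x / lam), for lam \<noteq> 0 *)
definition degen_exp :: "real \<Rightarrow> complex \<Rightarrow> complex fps" where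
  "degen_exp lam x = fps_cpower (1 + fps_const (of_real lam) * fps_X) (x / of_real lam)"

lemma degen_exp_nth:
  assumes "lam \<noteq> 0"
  shows "fps_nth (degen_exp lam x) n = degen_falling_fact lam x n / fact n"
proof -
  have "of_real lam ^ n * (\<Prod>i<n. x / of_real lam - of_nat i)
      = (\<Prod>i<n. of_real lam * (x / of_real lam - of_nat i))"
    by (simp add: prod.distrib)
  also have "\<dots> = degen_falling_fact lam x n"
    unfolding degen_falling_fact_def using assms by (intro prod.cong) (auto simp: field_simps)
  finally show ?thesis
    by (simp add: degen_exp_def fps_cpower_def gbinomial_prod_rev atLeast0LessThan)
qed

definition degen_euler_genocchi_gf :: "real \<Rightarrow> nat \<Rightarrow> complex \<Rightarrow> complex \<Rightarrow> complex fps" where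
  "degen_euler_genocchi_gf lam r \<alpha> x =
     fps_X ^ r * fps_cpower (2 / (degen_exp lam 1 + 1)) \<alpha> * degen_exp lam x"

definition degen_euler_genocchi :: "real \<Rightarrow> nat \<Rightarrow> complex \<Rightarrow> nat \<Rightarrow> complex \<Rightarrow> complex" where
  "degen_euler_genocchi lam r \<alpha> n x = fact n * fps_nth (degen_euler_genocchi_gf lam r \<alpha> x) n"

(* The base of the power in the generating function has constant term 1. *)
lemma degen_euler_base_nth_0:
  assumes "lam \<noteq> 0"
  shows "fps_nth (2 / (degen_exp lam 1 + 1)) 0 = 1"
proof -
  have "fps_nth (degen_exp lam 1) 0 = 1"
    using assms by (simp add: degen_exp_nth degen_falling_fact_def)
  then show ?thesis by (simp add: fps_divide_unit)
qed

(* S_{2,lam}(n,-) is the coefficient sequence of the degenerate falling factorial in the basis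
   of ordinary falling factorials; existence and uniqueness are shown below. *)
definition is_degen_stirling2_row :: "real \<Rightarrow> nat \<Rightarrow> (nat \<Rightarrow> complex) \<Rightarrow> bool" where
  "is_degen_stirling2_row lam n S \<longleftrightarrow>
     (\<forall>k>n. S k = 0) \<and>
     (\<forall>x. degen_falling_fact lam x n = (\<Sum>k=0..n. S k * falling_fact x k))"

definition degen_stirling2 :: "real \<Rightarrow> nat \<Rightarrow> nat \<Rightarrow> complex" where
  "degen_stirling2 lam n = (THE S. is_degen_stirling2_row lam n S)"

lemma falling_fact_Suc: "falling_fact x (Suc k) = falling_fact x k * (x - of_nat k)"
  by (simp add: falling_fact_def)

lemma is_degen_stirling2_row_exists: "\<exists>S. is_degen_stirling2_row lam n S"
proof (induction n)
  case 0
  show ?case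
    by (rule exI[of _ "\<lambda>k. if k = 0 then 1 else 0"])
       (simp add: is_degen_stirling2_row_def degen_falling_fact_def falling_fact_def)
next
  case (Suc n)
  then obtain S where S: "\<And>k. k > n \<Longrightarrow> S k = 0"
    "\<And>x. degen_falling_fact lam x n = (\<Sum>k=0..n. S k * falling_fact x k)"
    by (auto simp: is_degen_stirling2_row_def)
  define c where "c k = (of_nat k - of_nat n * of_real lam :: complex)" for k
  define T where "T k = (if k = 0 then 0 else S (k - 1)) + c k * S k" for k
  have "degen_falling_fact lam x (Suc n) = (\<Sum>k=0..Suc n. T k * falling_fact x k)" for x
  proof -
    have "degen_falling_fact lam x (Suc n)
        = (\<Sum>k=0..n. S k * falling_fact x k) * (x - of_nat n * of_real lam)"
      using S(2)[of x] by (simp add: degen_falling_fact_def)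
    also have "\<dots> = (\<Sum>k=0..n. S k * falling_fact x (Suc k) + c k * S k * falling_fact x k)"
      unfolding sum_distrib_right
      by (intro sum.cong) (auto simp: falling_fact_Suc c_def algebra_simps)
    also have "\<dots> = (\<Sum>k=0..n. S k * falling_fact x (Suc k))
        + (\<Sum>k=0..n. c k * S k * falling_fact x k)"
      by (simp add: sum.distrib)
    also have "(\<Sum>k=0..n. S k * falling_fact x (Suc k))
        = (\<Sum>k=0..Suc n. (if k = 0 then 0 else S (k - 1)) * falling_fact x k)"
      by (simp add: sum.atLeast0_atMost_Suc_shift del: sum.cl_ivl_Suc)
    also have "(\<Sum>k=0..n. c k * S k * falling_fact x k)
        = (\<Sum>k=0..Suc n. c k * S k * falling_fact x k)"
      using S(1)[of "Suc n"] by simp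
    finally show ?thesis
      by (simp add: T_def distrib_right sum.distrib del: sum.cl_ivl_Suc)
  qed
  moreover have "T k = 0" if "k > Suc n" for k
    using that S(1) by (simp add: T_def)
  ultimately show ?case
    by (auto simp: is_degen_stirling2_row_def)
qed

lemma is_degen_stirling2_row_unique:
  assumes "is_degen_stirling2_row lam n S" "is_degen_stirling2_row lam n T"
  shows "S = T"
proof
  fix m
  have zero: "falling_fact (of_nat m) k = 0" if "k > m" for k m
    using that by (auto simp: falling_fact_def intro!: prod_zero)
  have nonzero: "falling_fact (of_nat m) m \<noteq> 0" for m
    by (auto simp: falling_fact_def)
  show "S m = T m"
  proof (induction m rule: less_induct)
    case (less m)
    show ?case
    proof (cases "m \<le> n")
      case False
      then show ?thesis using assms by (simp add: is_degen_stirling2_row_def)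
    next
      case True
      have eq: "degen_falling_fact lam (of_nat m) n
          = (\<Sum>k<m. R k * falling_fact (of_nat m) k) + R m * falling_fact (of_nat m) m"
        if "is_degen_stirling2_row lam n R" for R
      proof -
        have "degen_falling_fact lam (of_nat m) n
            = (\<Sum>k=0..n. R k * falling_fact (of_nat m) k)"
          using that by (simp add: is_degen_stirling2_row_def)
        also have "\<dots> = (\<Sum>k<Suc m. R k * falling_fact (of_nat m) k)"
          using True zero[of m] by (intro sum.mono_neutral_right) auto
        finally show ?thesis by simp
      qed
      have "(\<Sum>k<m. S k * falling_fact (of_nat m) k)
          = (\<Sum>k<m. T k * falling_fact (of_nat m) k)"
        using less by (intro sum.cong) auto
      with eq[OF assms(1)] eq[OF assms(2)] nonzero show ?thesis by simp
    qed
  qed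
qed

lemma degen_stirling2_row: "is_degen_stirling2_row lam n (degen_stirling2 lam n)"
  unfolding degen_stirling2_def
  using is_degen_stirling2_row_exists is_degen_stirling2_row_unique by (metis theI')

lemma degen_falling_fact_eq_stirling2:
  "degen_falling_fact lam x n = (\<Sum>k=0..n. degen_stirling2 lam n k * falling_fact x k)"
  using degen_stirling2_row by (simp add: is_degen_stirling2_row_def)

end

theory Submission
  imports Defs
begin

(* Write F for the degenerate exponential e_lam(t). Since e_lam^x(t) = F^x = (1 + (F - 1))^x, the
   binomial series shows that (F - 1)^j / j! is the exponential generating function of
   S_{2,lam}(-, j). On the other hand
     (2 / (F + 1))^alpha = (1 + (F - 1) / 2)^(-alpha),
   and the same expansion gives its coefficients in terms of S_{2,lam}. Multiplying by e_lam^x(t)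
   and comparing coefficients yields the identity; the term k = n of the convolution is
   (x)_{n,lam}, and the terms with j = 0 and k < n vanish. *)

lemma falling_fact_eq_gbinomial: "falling_fact y k = fact k * (y gchoose k)"
  by (simp add: falling_fact_def gbinomial_prod_rev atLeast0LessThan)

text \<open>Used to cancel the \<open>fact (n + r)\<close> in \<open>degen_euler_genocchi\<close>
  against the normalizing factor, leaving \<open>fact n\<close>.\<close>

lemma falling_fact_of_nat_add: "falling_fact (of_nat (n + r)) r = fact (n + r) / fact n"
proof -
  have "of_nat ((n + r) choose r) = (fact (n + r) / (fact r * fact n) :: complex)"
    by (simp add: binomial_fact)
  then show ?thesis
    by (simp add: falling_fact_eq_gbinomial del: of_nat_add flip: binomial_gbinomial)
qed

lemma fps_cpower_nth:
  "fps_nth (fps_cpower F a) n = (\<Sum>j=0..n. (a gchoose j) * fps_nth ((F - 1) ^ j) n)"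
  by (simp add: fps_cpower_def fps_compose_nth)

lemma fps_cpower_nth_0 [simp]: "fps_nth (fps_cpower F a) 0 = 1"
  by (simp add: fps_cpower_def)

(* Both sides solve (1 + X) y' = a b y, y(0) = 1. *)
lemma fps_cpower_fps_binomial:
  "fps_cpower (fps_binomial a) b = fps_binomial (a * b)"
proof -
  let ?H = "fps_binomial a - 1"
  have H0: "fps_nth ?H 0 = 0" by simp
  have unit: "fps_nth (1 + fps_X :: complex fps) 0 \<noteq> 0" by simp
  have inv: "fps_binomial a * inverse (fps_binomial a) = 1"
    by (simp add: inverse_mult_eq_1')
  have "fps_deriv (fps_cpower (fps_binomial a) b)
      = (fps_const b * fps_binomial b * inverse (1 + fps_X) oo ?H) * fps_deriv (fps_binomial a)"
    by (simp add: fps_cpower_def fps_compose_deriv[OF H0] fps_binomial_deriv fps_divide_unit)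
  \<comment> \<open>Composing \<open>1 + fps_X\<close> with \<open>?H\<close> gives
    \<open>fps_binomial a\<close>, whence the last factor.\<close>
  also have "fps_const b * fps_binomial b * inverse (1 + fps_X) oo ?H
      = fps_const b * fps_cpower (fps_binomial a) b * inverse (fps_binomial a)"
    by (simp add: fps_cpower_def fps_compose_mult_distrib[OF H0] fps_inverse_compose[OF H0 unit]
        fps_compose_add_distrib fps_X_fps_compose_startby0[OF H0])
  \<comment> \<open>The inner derivative contributes a factor \<open>fps_binomial a\<close>, which
    cancels the inverse.\<close>
  also have "\<dots> * fps_deriv (fps_binomial a)
      = fps_const (a * b) * fps_cpower (fps_binomial a) b * inverse (1 + fps_X)
        * (fps_binomial a * inverse (fps_binomial a))"
    by (simp add: fps_binomial_deriv fps_divide_unit mult_ac flip: fps_const_mult)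
  finally show ?thesis
    using fps_binomial_ODE_unique'[of "fps_cpower (fps_binomial a) b" "a * b"]
    by (simp add: inv fps_divide_unit)
qed

text \<open>Associativity of composition reduces this to the binomial series:
  \<open>fps_cpower F a - 1\<close> is \<open>fps_binomial a - 1\<close> composed with
  \<open>F - 1\<close>.\<close>

lemma fps_cpower_cpower:
  assumes "fps_nth F 0 = 1"
  shows "fps_cpower (fps_cpower F a) b = fps_cpower F (a * b)"
proof -
  have F0: "fps_nth (F - 1) 0 = 0" using assms by simp
  have "fps_cpower (fps_cpower F a) b = fps_binomial b oo ((fps_binomial a - 1) oo (F - 1))"
    by (simp add: fps_cpower_def fps_compose_sub_distrib)
  also have "\<dots> = fps_cpower (fps_binomial a) b oo (F - 1)"
    by (simp add: fps_cpower_def fps_compose_assoc[OF F0])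
  finally show ?thesis
    by (simp add: fps_cpower_fps_binomial) (simp add: fps_cpower_def)
qed

lemma fps_cpower_uminus_one:
  assumes "fps_nth F 0 = 1"
  shows "fps_cpower F (- 1) = inverse F"
proof -
  have F0: "fps_nth (F - 1) 0 = 0" using assms by simp
  have unit: "fps_nth (1 + fps_X :: complex fps) 0 \<noteq> 0" by simp
  show ?thesis
    by (simp add: fps_cpower_def fps_binomial_minus_one fps_inverse_compose[OF F0 unit]
        fps_compose_add_distrib fps_X_fps_compose_startby0[OF F0])
qed

lemma degen_exp_nth_0: "fps_nth (degen_exp lam x) 0 = 1"
  by (simp add: degen_exp_def)

text \<open>The nested power law applied to \<open>x / lam = (1 / lam) * x\<close>. Moving
  \<open>x\<close> into the outer exponent lets the binomial series produce falling factorials of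
  \<open>x\<close>.\<close>

lemma degen_exp_eq_cpower: "degen_exp lam x = fps_cpower (degen_exp lam 1) x"
  by (simp add: degen_exp_def fps_cpower_cpower)

text \<open>Expanding \<open>fps_cpower (degen_exp lam 1) x\<close> by the binomial series shows
  that the right-hand side is a Stirling row; rows are unique.\<close>

lemma degen_stirling2_eq_nth:
  assumes "lam \<noteq> 0"
  shows "degen_stirling2 lam n k = fact n / fact k * fps_nth ((degen_exp lam 1 - 1) ^ k) n"
proof -
  define S where "S k = fact n / fact k * fps_nth ((degen_exp lam 1 - 1) ^ k) n" for k
  \<comment> \<open>The base has zero constant term, so its \<open>k\<close>-th power has no terms
    below degree \<open>k\<close>.\<close>
  have "S k = 0" if "k > n" for k
    using startsby_zero_power_prefix[of "degen_exp lam 1 - 1" k] that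
    by (simp add: S_def degen_exp_nth_0)
  moreover have "degen_falling_fact lam x n = (\<Sum>k=0..n. S k * falling_fact x k)" for x
  proof -
    have "degen_falling_fact lam x n = fact n * fps_nth (fps_cpower (degen_exp lam 1) x) n"
      using assms by (simp add: degen_exp_nth flip: degen_exp_eq_cpower)
    then show ?thesis
      by (simp add: fps_cpower_nth sum_distrib_left S_def falling_fact_eq_gbinomial mult_ac)
  qed
  ultimately have "is_degen_stirling2_row lam n S"
    by (simp add: is_degen_stirling2_row_def)
  then have "degen_stirling2 lam n = S"
    using is_degen_stirling2_row_unique degen_stirling2_row by blast
  then show ?thesis by (simp add: S_def)
qed

lemma degen_stirling2_n_0:
  assumes "lam \<noteq> 0"
  shows "degen_stirling2 lam n 0 = (if n = 0 then 1 else 0)"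
  using assms by (simp add: degen_stirling2_eq_nth)

lemma degen_euler_cpower_eq:
  "fps_cpower (2 / (degen_exp lam 1 + 1)) \<alpha>
    = fps_cpower (1 + fps_const (1/2) * (degen_exp lam 1 - 1)) (- \<alpha>)"
proof -
  let ?F = "degen_exp lam 1" and ?G = "1 + fps_const (1/2) * (degen_exp lam 1 - 1)"
  have G0: "fps_nth ?G 0 = 1" by (simp add: degen_exp_nth_0)
  have half: "2 * fps_const (1/2 :: complex) = 1"
    by (simp add: fps_eq_iff numeral_fps_const)
  have "2 * ?G = 2 + (2 * fps_const (1/2)) * (?F - 1)"
    by (simp add: algebra_simps)
  then have "?F + 1 = 2 * ?G" unfolding half by simp
  \<comment> \<open>A nonzero constant term allows division to be replaced by multiplication with
    \<open>inverse\<close>.\<close>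
  moreover have "fps_nth (2 * ?G) 0 \<noteq> 0"
    using G0 by (simp add: numeral_fps_const)
  ultimately have "2 / (?F + 1) = 2 * inverse (2 * ?G)"
    by (metis fps_divide_unit)
  also have "\<dots> = (2 * inverse 2) * inverse ?G"
    by (simp only: fps_inverse_mult mult.assoc)
  also have "2 * inverse 2 = (1 :: complex fps)"
    by (rule inverse_mult_eq_1') (simp add: numeral_fps_const)
  finally have "2 / (?F + 1) = fps_cpower ?G (- 1)"
    by (simp add: fps_cpower_uminus_one[OF G0])
  then show ?thesis by (simp add: fps_cpower_cpower[OF G0])
qed

lemma degen_euler_cpower_nth:
  assumes "lam \<noteq> 0"
  shows "fact m * fps_nth (fps_cpower (2 / (degen_exp lam 1 + 1)) \<alpha>) m
    = (\<Sum>j=0..m. falling_fact (-\<alpha>) j * (1/2) ^ j * degen_stirling2 lam m j)"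
  unfolding degen_euler_cpower_eq fps_cpower_nth sum_distrib_left
  by (intro sum.cong)
     (simp_all add: degen_stirling2_eq_nth[OF assms] falling_fact_eq_gbinomial
        power_mult_distrib fps_const_power)

text \<open>The factor \<open>fps_X ^ r\<close> only shifts the index by \<open>r\<close>, so the
  left-hand side is \<open>fact n\<close> times a coefficient of a product of two series, that is, a
  binomial convolution.\<close>

lemma degen_euler_genocchi_eq_sum:
  assumes "lam \<noteq> 0"
  shows "1 / falling_fact (of_nat (n + r)) r * degen_euler_genocchi lam r \<alpha> (n + r) x
    = (\<Sum>k=0..n. \<Sum>j=0..n-k. falling_fact (-\<alpha>) j * (1/2) ^ j * of_nat (n choose k)
        * degen_stirling2 lam (n - k) j * degen_falling_fact lam x k)"
proof -
  let ?C = "fps_cpower (2 / (degen_exp lam 1 + 1)) \<alpha>"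
  have "1 / falling_fact (of_nat (n + r)) r * degen_euler_genocchi lam r \<alpha> (n + r) x
      = fact n * fps_nth (degen_exp lam x * ?C) n"
    by (simp add: falling_fact_of_nat_add degen_euler_genocchi_def degen_euler_genocchi_gf_def
        mult.assoc fps_X_power_mult_nth mult.commute[of ?C] del: of_nat_add)
  also have "\<dots> = (\<Sum>k=0..n. of_nat (n choose k) * degen_falling_fact lam x k
      * (fact (n - k) * fps_nth ?C (n - k)))"
    unfolding fps_mult_nth sum_distrib_left
    by (intro sum.cong) (simp_all add: degen_exp_nth[OF assms] binomial_fact)
  also have "\<dots> = (\<Sum>k=0..n. \<Sum>j=0..n-k. falling_fact (-\<alpha>) j * (1/2) ^ j
      * of_nat (n choose k) * degen_stirling2 lam (n - k) j * degen_falling_fact lam x k)"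
    unfolding degen_euler_cpower_nth[OF assms] sum_distrib_left
    by (intro sum.cong) (simp_all add: mult_ac)
  finally show ?thesis .
qed

theorem theorem7:
  fixes lam :: real and \<alpha> x :: complex and r n :: nat
  assumes "lam \<noteq> 0" and "\<alpha> \<noteq> 0" and "n \<ge> 1"
  shows "degen_falling_fact lam x n =
      1 / falling_fact (of_nat (n + r)) r * degen_euler_genocchi lam r \<alpha> (n + r) x
      - (\<Sum>k=0..n-1. \<Sum>j=1..n-k. falling_fact (-\<alpha>) j * (1/2) ^ j * of_nat (n choose k)
            * degen_stirling2 lam (n - k) j * degen_falling_fact lam x k)"
proof -
  let ?f = "\<lambda>k j. falling_fact (-\<alpha>) j * (1/2) ^ j * of_nat (n choose k)
            * degen_stirling2 lam (n - k) j * degen_falling_fact lam x k"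
  have "(\<Sum>k=0..n. \<Sum>j=0..n-k. ?f k j)
      = (\<Sum>k=0..n-1. \<Sum>j=0..n-k. ?f k j) + (\<Sum>j=0..n-n. ?f n j)"
    \<comment> \<open>For \<open>n = 0\<close> the truncated \<open>n - 1\<close> would count the
      term \<open>k = n\<close> twice.\<close>
    using \<open>n \<ge> 1\<close> by (cases n) simp_all
  also have "(\<Sum>j=0..n-n. ?f n j) = degen_falling_fact lam x n"
    by (simp add: degen_stirling2_n_0[OF \<open>lam \<noteq> 0\<close>] falling_fact_def)
  also have "(\<Sum>k=0..n-1. \<Sum>j=0..n-k. ?f k j) = (\<Sum>k=0..n-1. \<Sum>j=1..n-k. ?f k j)"
  proof (rule sum.cong)
    fix k assume "k \<in> {0..n-1}"
    \<comment> \<open>Here \<open>k < n\<close>, so \<open>n - k\<close> is positive and its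
      Stirling number at 0 vanishes.\<close>
    then have "?f k 0 = 0"
      using \<open>n \<ge> 1\<close> by (auto simp: degen_stirling2_n_0[OF \<open>lam \<noteq> 0\<close>])
    then show "(\<Sum>j=0..n-k. ?f k j) = (\<Sum>j=1..n-k. ?f k j)"
      by (simp add: sum.atLeast_Suc_atMost)
  qed simp
  finally show ?thesis
    unfolding degen_euler_genocchi_eq_sum[OF \<open>lam \<noteq> 0\<close>] by simp
qed

end
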